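(* Let $N\geq 2$. The algebra of all linear operators $X$ on $\mathcal{H}_N=(\mathbb{C}^2)^{\otimes N}$ satisfying $[X,\rho(\mathsf{E})]=[X,\rho(\mathsf{F})]=[X,\rho(\mathsf{K})]=0$ (the centralizer of the restricted quantum group at $\mathfrak{q}=i$ in the open XX chain) is generated, as a unital associative algebra, by the operators $$e_k=c_kc_{k+1}^\dagger+c_{k+1}c_k^\dagger+i\bigl(c_k^\dagger c_k-c_{k+1}^\dagger c_{k+1}\bigr),\qquad 1\leq k\leq N-1,$$ and $$W\!B^+_j=(-1)^j\bigl(c_j^\dagger c_{j+1}^\dagger+i\,c_j^\dagger c_{j+2}^\dagger-c_{j+1}^\dagger c_{j+2}^\dagger\bigr),$$ $$W\!B^0_j=-\tfrac12\bigl(1+i c_j^\dagger c_{j+1}-c_j^\dagger c_{j+2}+i c_{j+1}^\dagger c_j-2c_{j+1}^\dagger c_{j+1}-i c_{j+1}^\dagger c_{j+2}-c_{j+2}^\dagger c_j-i c_{j+2}^\dagger c_{j+1}\bigr),$$ $$W\!B^-_j=(-1)^{j+1}\bigl(c_jc_{j+1}+i\,c_jc_{j+2}-c_{j+1}c_{j+2}\bigr),$$ for $1\leq j\leq N-2$ (for $N=2$ there are no $W\!B$ generators).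
   Context: $\sigma^x,\sigma^y,\sigma^z$ are the Pauli matrices, $\sigma^+=\begin{pmatrix}0&1\\0&0\end{pmatrix}$, $\sigma^-=\begin{pmatrix}0&0\\1&0\end{pmatrix}$, and $\sigma^a_j$ denotes $\sigma^a$ acting on the $j$-th tensor factor of $\mathcal{H}_N=(\mathbb{C}^2)^{\otimes N}$. Lattice fermions are defined by the Jordan–Wigner transformation $c_j^\dagger=i^{j-1}\,i^{\sigma^z_1+\dots+\sigma^z_{j-1}}\sigma^+_j$, $c_j=i^{-j+1}\,i^{-\sigma^z_1-\dots-\sigma^z_{j-1}}\sigma^-_j$, so that $\{c_j^\dagger,c_{j'}\}=\delta_{j,j'}$. The representation $\rho$ of the restricted quantum group $\overline{U}_i s\ell(2)$ (at $\mathfrak{q}=i$) on $\mathcal{H}_N$ is given by $\rho(\mathsf{K})=i^N\,\sigma^z\otimes\cdots\otimes\sigma^z$, $\rho(\mathsf{E})=\bigl(\sum_{j=1}^N i^j c_j^\dagger\bigr)\rho(\mathsf{K})$, $\rho(\mathsf{F})=\sum_{j=1}^N i^{j-1}c_j$. *)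

theory Defs
  imports Complex_Main "Jordan_Normal_Form.Matrix"
begin

text \<open>Operators on H_N = (C^2)^(tensor N) are complex 2^N x 2^N matrices.
  Basis index n < 2^N; the tensor factor j (1 \<le> j \<le> N) corresponds to the digit
  (n div 2^(N-j)) mod 2 (Kronecker-product convention, factor 1 most significant).
  Digit 0 is the first basis vector of C^2, digit 1 the second.\<close>

definition bitN :: "nat \<Rightarrow> nat \<Rightarrow> nat \<Rightarrow> nat" where
  "bitN N j n = (n div 2 ^ (N - j)) mod 2"

definition site_op :: "nat \<Rightarrow> nat \<Rightarrow> complex mat \<Rightarrow> complex mat" where
  "site_op N j A = mat (2^N) (2^N) (\<lambda>(r, c).
     if (\<forall>k\<in>{1..N} - {j}. bitN N k r = bitN N k c) then A $$ (bitN N j r, bitN N j c) else 0)"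

definition sigma_plus :: "complex mat" where
  "sigma_plus = mat 2 2 (\<lambda>(r, c). if r = 0 \<and> c = 1 then 1 else 0)"

definition sigma_minus :: "complex mat" where
  "sigma_minus = mat 2 2 (\<lambda>(r, c). if r = 1 \<and> c = 0 then 1 else 0)"

definition sigma_z :: "complex mat" where
  "sigma_z = mat 2 2 (\<lambda>(r, c). if r = c then (if r = 0 then 1 else -1) else 0)"

definition zval :: "nat \<Rightarrow> nat \<Rightarrow> nat \<Rightarrow> int" where
  "zval N k n = (if bitN N k n = 0 then 1 else -1)"

text \<open>The operator i^(e (sigma^z_1 + ... + sigma^z_(j-1))), e = 1 or -1: since the
  sigma^z_k are commuting diagonal operators with eigenvalues \<plusminus>1, this is the
  diagonal operator with entries i^(e * sum of eigenvalues).\<close>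
definition jw_string :: "nat \<Rightarrow> int \<Rightarrow> nat \<Rightarrow> complex mat" where
  "jw_string N e j = mat (2^N) (2^N) (\<lambda>(r, c).
     if r = c then \<i> powi (e * (\<Sum>k\<in>{1..<j}. zval N k r)) else 0)"

definition cdag :: "nat \<Rightarrow> nat \<Rightarrow> complex mat" where
  "cdag N j = (\<i> ^ (j - 1)) \<cdot>\<^sub>m (jw_string N 1 j * site_op N j sigma_plus)"

definition cann :: "nat \<Rightarrow> nat \<Rightarrow> complex mat" where
  "cann N j = (\<i> powi (- int j + 1)) \<cdot>\<^sub>m (jw_string N (-1) j * site_op N j sigma_minus)"

definition msum :: "nat \<Rightarrow> (nat \<Rightarrow> complex mat) \<Rightarrow> nat set \<Rightarrow> complex mat" where
  "msum d f A = mat d d (\<lambda>ij. \<Sum>k\<in>A. f k $$ ij)"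

definition mprod :: "nat \<Rightarrow> complex mat list \<Rightarrow> complex mat" where
  "mprod d xs = foldr (*) xs (1\<^sub>m d)"

definition rhoK :: "nat \<Rightarrow> complex mat" where
  "rhoK N = (\<i> ^ N) \<cdot>\<^sub>m mprod (2^N) (map (\<lambda>k. site_op N k sigma_z) [1..<N+1])"

definition rhoE :: "nat \<Rightarrow> complex mat" where
  "rhoE N = msum (2^N) (\<lambda>j. (\<i> ^ j) \<cdot>\<^sub>m cdag N j) {1..N} * rhoK N"

definition rhoF :: "nat \<Rightarrow> complex mat" where
  "rhoF N = msum (2^N) (\<lambda>j. (\<i> ^ (j - 1)) \<cdot>\<^sub>m cann N j) {1..N}"

definition centralizer :: "nat \<Rightarrow> complex mat set" where
  "centralizer N = {X \<in> carrier_mat (2^N) (2^N).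
      X * rhoE N - rhoE N * X = 0\<^sub>m (2^N) (2^N) \<and>
      X * rhoF N - rhoF N * X = 0\<^sub>m (2^N) (2^N) \<and>
      X * rhoK N - rhoK N * X = 0\<^sub>m (2^N) (2^N)}"

definition e_gen :: "nat \<Rightarrow> nat \<Rightarrow> complex mat" where
  "e_gen N k = cann N k * cdag N (k+1) + cann N (k+1) * cdag N k
     + \<i> \<cdot>\<^sub>m (cdag N k * cann N k - cdag N (k+1) * cann N (k+1))"

definition WBp :: "nat \<Rightarrow> nat \<Rightarrow> complex mat" where
  "WBp N j = ((-1) ^ j) \<cdot>\<^sub>m (cdag N j * cdag N (j+1) + \<i> \<cdot>\<^sub>m (cdag N j * cdag N (j+2))
     - cdag N (j+1) * cdag N (j+2))"

definition WB0 :: "nat \<Rightarrow> nat \<Rightarrow> complex mat" where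
  "WB0 N j = (- 1/2) \<cdot>\<^sub>m (1\<^sub>m (2^N) + \<i> \<cdot>\<^sub>m (cdag N j * cann N (j+1)) - cdag N j * cann N (j+2)
     + \<i> \<cdot>\<^sub>m (cdag N (j+1) * cann N j) - 2 \<cdot>\<^sub>m (cdag N (j+1) * cann N (j+1))
     - \<i> \<cdot>\<^sub>m (cdag N (j+1) * cann N (j+2)) - cdag N (j+2) * cann N j
     - \<i> \<cdot>\<^sub>m (cdag N (j+2) * cann N (j+1)))"

definition WBm :: "nat \<Rightarrow> nat \<Rightarrow> complex mat" where
  "WBm N j = ((-1) ^ (j+1)) \<cdot>\<^sub>m (cann N j * cann N (j+1) + \<i> \<cdot>\<^sub>m (cann N j * cann N (j+2))
     - cann N (j+1) * cann N (j+2))"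

definition generators :: "nat \<Rightarrow> complex mat set" where
  "generators N = {e_gen N k | k. 1 \<le> k \<and> k \<le> N - 1}
     \<union> {WBp N j | j. 1 \<le> j \<and> j \<le> N - 2}
     \<union> {WB0 N j | j. 1 \<le> j \<and> j \<le> N - 2}
     \<union> {WBm N j | j. 1 \<le> j \<and> j \<le> N - 2}"

inductive_set gen_alg :: "nat \<Rightarrow> complex mat set \<Rightarrow> complex mat set" for d S where
  one: "1\<^sub>m d \<in> gen_alg d S"
| gen: "x \<in> S \<Longrightarrow> x \<in> gen_alg d S"
| add: "x \<in> gen_alg d S \<Longrightarrow> y \<in> gen_alg d S \<Longrightarrow> x + y \<in> gen_alg d S"
| mult: "x \<in> gen_alg d S \<Longrightarrow> y \<in> gen_alg d S \<Longrightarrow> x * y \<in> gen_alg d S"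
| smult: "x \<in> gen_alg d S \<Longrightarrow> a \<cdot>\<^sub>m x \<in> gen_alg d S"

end

theory Submission
  imports Defs
begin

text \<open>
  The combinations \<open>D\<^sub>k = cdag k + i cdag (k+1)\<close> and \<open>d\<^sub>k = cann k + i cann (k+1)\<close> anticommute with the
  odd operators \<open>A = \<Sum> i^j cdag j\<close> and \<open>B = \<Sum> i^(j-1) cann j\<close>, so products of two of them commute with
  \<open>rhoE\<close>, \<open>rhoF\<close> and \<open>rhoK\<close>. Up to scalars \<open>e_gen k\<close> is \<open>D\<^sub>k d\<^sub>k\<close>, \<open>WBp j\<close> is \<open>D\<^sub>j D\<^sub>j\<^sub>+\<^sub>1\<close>,
  \<open>WBm j\<close> is \<open>d\<^sub>j d\<^sub>j\<^sub>+\<^sub>1\<close>, and \<open>WB0 j\<close> is \<open>D\<^sub>j d\<^sub>j\<^sub>+\<^sub>1 + D\<^sub>j\<^sub>+\<^sub>1 d\<^sub>j\<close> up to a constant; commutators of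
  these yield all products of two elements among the \<open>D\<^sub>k\<close>, \<open>d\<^sub>k\<close>. With \<open>p = cann 1\<close> and \<open>q = cdag 1\<close>
  every operator is \<open>a + p b + q c + p q d\<close> with \<open>a, b, c, d\<close> polynomials in the \<open>D\<^sub>k\<close>, \<open>d\<^sub>k\<close>.
  Commuting with \<open>rhoK\<close> forces the operator to be even. As \<open>A p + p A\<close> and \<open>B q + q B\<close> are nonzero
  scalars while \<open>A q + q A = B p + p B = 0\<close>, commuting with \<open>A\<close> and \<open>B\<close> forces \<open>b = c = d = 0\<close>.
\<close>

section \<open>Fermion algebras\<close>

definition acomm :: "'a::ring_1 \<Rightarrow> 'a \<Rightarrow> 'a" where
  "acomm x y = x * y + y * x"

lemma acomm_sym: "acomm x y = acomm y x"
  by (simp add: acomm_def add.commute)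

lemma acomm_add_left: "acomm (x + y) z = acomm x z + acomm y z"
  by (simp add: acomm_def algebra_simps)

lemma acomm_add_right: "acomm x (y + z) = acomm x y + acomm x z"
  by (simp add: acomm_def algebra_simps)

lemma acomm_sum_left: "acomm (sum g I) z = (\<Sum>i\<in>I. acomm (g i) z)"
  by (simp add: acomm_def sum_distrib_left sum_distrib_right sum.distrib)

text \<open>Moving \<open>u\<close> and then \<open>v\<close> to the left past \<open>b\<close> and
  \<open>a\<close> costs one anticommutator per exchange. When these are scalars, the commutator of
  two quadratic elements is again quadratic, which is how new pairs of links are obtained from old
  ones.\<close>

lemma commutator_products:
  fixes a b u v :: "'a::ring_1"
  shows "a * b * (u * v) - u * v * (a * b) =
    a * acomm b u * v - a * u * acomm b v + acomm a u * v * b - u * acomm a v * b"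
  by (simp add: acomm_def algebra_simps)

text \<open>The complex numbers enter as central ring elements, so multiplication by a scalar is
  ordinary multiplication in the ring.\<close>

locale complex_algebra =
  fixes sc :: "complex \<Rightarrow> 'a::ring_1"
  assumes sc_add: "sc (a + b) = sc a + sc b"
    and sc_mult: "sc (a * b) = sc a * sc b"
    and sc_1: "sc 1 = 1"
    and sc_commute: "x * sc a = sc a * x"
begin

lemma sc_0: "sc 0 = 0"
  using sc_add[of 0 0] by simp

lemma sc_minus: "sc (- a) = - sc a"
  using sc_add[of a "- a"] by (simp add: sc_0 eq_neg_iff_add_eq_0 add.commute)

lemma sc_left_commute: "x * (sc a * y) = sc a * (x * y)"
  by (metis mult.assoc sc_commute)

lemma sc_cancel:
  assumes "a \<noteq> 0"
  shows "sc a * x = 0 \<longleftrightarrow> x = 0"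
proof -
  have "sc (1 / a) * (sc a * x) = x"
    using assms by (simp add: mult.assoc[symmetric] sc_mult[symmetric] sc_1)
  then show ?thesis
    by auto
qed

lemma two_scale: "x + x = sc 2 * x"
  using sc_add[of 1 1] by (simp add: sc_1 mult_2)

lemma two_cancel: "x + x = 0 \<Longrightarrow> x = (0 :: 'a)"
  by (simp add: two_scale sc_cancel)

lemma acomm_sc_left: "acomm (sc a * x) y = sc a * acomm x y"
  by (simp add: acomm_def algebra_simps sc_left_commute)

lemma acomm_sc_right: "acomm x (sc a * y) = sc a * acomm x y"
  by (metis acomm_sc_left acomm_sym)

end

text \<open>\<open>f True\<close> plays the creation operators and \<open>f False\<close> the
  annihilation operators; \<open>P\<close> abstracts \<open>rhoK\<close>, of which only the
  anticommutation with each fermion and a left inverse \<open>Q\<close> are recorded.\<close>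

locale fermions = complex_algebra sc for sc :: "complex \<Rightarrow> 'a::ring_1" +
  fixes N :: nat and f :: "bool \<Rightarrow> nat \<Rightarrow> 'a" and P Q :: 'a
  assumes N: "N \<ge> 1"
    and car: "j \<in> {1..N} \<Longrightarrow> k \<in> {1..N} \<Longrightarrow>
      acomm (f \<sigma> j) (f \<tau> k) = of_bool (j = k \<and> \<sigma> \<noteq> \<tau>)"
    and acomm_P: "j \<in> {1..N} \<Longrightarrow> acomm P (f \<sigma> j) = 0"
    and QP: "Q * P = 1"
begin

text \<open>\<open>link True k\<close> and \<open>link False k\<close> are \<open>D\<^sub>k\<close> and \<open>d\<^sub>k\<close>; \<open>charge True\<close> is \<open>A\<close> and
  \<open>charge False\<close> is \<open>i B\<close>.\<close>

definition link :: "bool \<Rightarrow> nat \<Rightarrow> 'a" where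
  "link \<sigma> k = f \<sigma> k + sc \<i> * f \<sigma> (k + 1)"

definition charge :: "bool \<Rightarrow> 'a" where
  "charge \<sigma> = (\<Sum>j\<in>{1..N}. sc (\<i> ^ j) * f \<sigma> j)"

lemma acomm_f_link:
  assumes "j \<in> {1..N}" "k \<in> {1..<N}"
  shows "acomm (f \<sigma> j) (link \<tau> k) =
    (if \<sigma> = \<tau> then 0 else if j = k then 1 else if j = k + 1 then sc \<i> else 0)"
  using assms by (simp add: link_def acomm_add_right acomm_sc_right car)

text \<open>On the diagonal \<open>j = k\<close> the two contributions \<open>1\<close> and
  \<open>\<i> * \<i>\<close> cancel, so only neighbouring links of opposite type fail to
  anticommute.\<close>

lemma acomm_link_link:
  assumes "j \<in> {1..<N}" "k \<in> {1..<N}"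
  shows "acomm (link \<sigma> j) (link \<tau> k) =
    (if \<sigma> \<noteq> \<tau> \<and> (j = k + 1 \<or> k = j + 1) then sc \<i> else 0)"
proof -
  have "sc \<i> * sc \<i> = -1"
    by (simp add: sc_mult[symmetric] sc_minus sc_1)
  then show ?thesis
    using assms
    by (simp add: link_def[of \<sigma>] acomm_add_left acomm_sc_left acomm_f_link)
qed

lemma acomm_charge_f:
  assumes "j \<in> {1..N}"
  shows "acomm (charge \<sigma>) (f \<tau> j) = (if \<sigma> = \<tau> then 0 else sc (\<i> ^ j))"
proof -
  have "acomm (charge \<sigma>) (f \<tau> j) = (\<Sum>k\<in>{1..N}. sc (\<i> ^ k) * acomm (f \<sigma> k) (f \<tau> j))"
    by (simp add: charge_def acomm_sum_left acomm_sc_left)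
  also have "\<dots> = (\<Sum>k\<in>{1..N}. if k = j then (if \<sigma> = \<tau> then 0 else sc (\<i> ^ k)) else 0)"
    by (rule sum.cong) (use assms in \<open>auto simp: car\<close>)
  finally show ?thesis
    using assms by simp
qed

text \<open>For opposite types the two sites of a link contribute \<open>\<i> ^ k\<close> and
  \<open>\<i> * \<i> ^ (k + 1)\<close>, which cancel; this fixes the coefficient \<open>\<i>\<close>
  in \<open>link\<close>.\<close>

lemma acomm_charge_link:
  assumes "k \<in> {1..<N}"
  shows "acomm (charge \<sigma>) (link \<tau> k) = 0"
proof -
  have "sc \<i> * sc (\<i> ^ Suc k) = - sc (\<i> ^ k)"
    by (simp add: sc_mult[symmetric] sc_minus[symmetric])
  then show ?thesis
    using assms by (simp add: link_def acomm_add_right acomm_sc_right acomm_charge_f del: power_Suc)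
qed

lemma acomm_P_link: "k \<in> {1..<N} \<Longrightarrow> acomm P (link \<tau> k) = 0"
  by (simp add: link_def acomm_add_right acomm_sc_right acomm_P)

lemma link_mult: "link \<sigma> j * link \<tau> k = f \<sigma> j * f \<tau> k + sc \<i> * (f \<sigma> j * f \<tau> (k + 1))
    + sc \<i> * (f \<sigma> (j + 1) * f \<tau> k) - f \<sigma> (j + 1) * f \<tau> (k + 1)"
proof -
  have "sc \<i> * (sc \<i> * x) = - x" for x
    by (simp add: mult.assoc[symmetric] sc_mult[symmetric] sc_minus sc_1)
  then show ?thesis
    by (simp add: link_def distrib_left distrib_right mult.assoc sc_left_commute[of "f _ _"])
qed

lemma f_square:
  assumes "j \<in> {1..N}"
  shows "f \<sigma> j * f \<sigma> j = 0"
  using car[OF assms assms, of \<sigma> \<sigma>] two_cancel[of "f \<sigma> j * f \<sigma> j"] by (simp add: acomm_def)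

lemma commute_product:
  assumes "acomm y a = 0" "acomm y b = 0"
  shows "y * (a * b) = a * b * y"
proof -
  have *: "y * a = - (a * y)" "y * b = - (b * y)"
    using assms by (simp_all add: acomm_def eq_neg_iff_add_eq_0)
  have "y * (a * b) = - (a * (y * b))"
    by (simp only: *(1) mult.assoc[symmetric] mult_minus_left)
  then show ?thesis
    by (simp add: *(2) mult.assoc)
qed

end

text \<open>Since \<open>link \<sigma> k\<close> anticommutes with every \<open>charge \<tau>\<close>, products of two links lie in the
  commutant; \<open>G\<close> is a subalgebra containing only those pairs that occur in the generators.\<close>

locale even_subalgebra = fermions +
  fixes G :: "'a set"
  assumes G_sc: "sc a \<in> G"
    and G_add: "x \<in> G \<Longrightarrow> y \<in> G \<Longrightarrow> x + y \<in> G"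
    and G_mult: "x \<in> G \<Longrightarrow> y \<in> G \<Longrightarrow> x * y \<in> G"
    and G_charge: "x \<in> G \<Longrightarrow> charge \<sigma> * x = x * charge \<sigma>"
    and G_P: "x \<in> G \<Longrightarrow> P * x = x * P"
    and G_cartan: "j \<in> {1..<N} \<Longrightarrow> link True j * link False j \<in> G"
    and G_simple: "1 \<le> j \<Longrightarrow> j + 1 < N \<Longrightarrow> link \<sigma> j * link \<sigma> (j + 1) \<in> G"
    and G_mixed: "1 \<le> j \<Longrightarrow> j + 1 < N \<Longrightarrow>
      link True j * link False (j + 1) + link True (j + 1) * link False j \<in> G"
begin

lemma G_scale: "x \<in> G \<Longrightarrow> sc a * x \<in> G"
  by (rule G_mult[OF G_sc])

lemma G_minus: "x \<in> G \<Longrightarrow> - x \<in> G"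
  using G_scale[of x "-1"] by (simp add: sc_minus sc_1)

lemma G_diff: "x \<in> G \<Longrightarrow> y \<in> G \<Longrightarrow> x - y \<in> G"
  using G_add[OF _ G_minus] by simp

lemma G_zero: "0 \<in> G"
  using G_sc[of 0] by (simp add: sc_0)

lemma G_commutator: "x \<in> G \<Longrightarrow> y \<in> G \<Longrightarrow> x * y - y * x \<in> G"
  by (simp add: G_diff G_mult)

lemma G_scale_iff: "a \<noteq> 0 \<Longrightarrow> sc a * x \<in> G \<longleftrightarrow> x \<in> G"
  using G_scale[of "sc a * x" "1 / a"] G_scale[of x a]
  by (auto simp: mult.assoc[symmetric] sc_mult[symmetric] sc_1)

lemma G_cartan':
  assumes "j \<in> {1..<N}"
  shows "link \<sigma> j * link (\<not> \<sigma>) j \<in> G"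
proof (cases \<sigma>)
  case False
  have "link False j * link True j = - (link True j * link False j)"
    using acomm_link_link[OF assms assms, of False True]
      by (simp add: acomm_def eq_neg_iff_add_eq_0)
  then show ?thesis
    using G_minus[OF G_cartan[OF assms]] False by simp
qed (use G_cartan[OF assms] in simp)

text \<open>In the commutator with the pair \<open>?w * ?w'\<close> at \<open>k + 1\<close> only the
  anticommutator of \<open>link \<tau> k\<close> with \<open>?w'\<close> survives:
  \<open>j < k\<close> keeps \<open>link \<sigma> j\<close> away from site \<open>k + 1\<close>
  links, so the second factor moves one step to the right.\<close>

lemma G_link_step:
  assumes "1 \<le> j" "j < k" "k + 1 < N" "link \<sigma> j * link \<tau> k \<in> G"
  shows "link \<sigma> j * link \<tau> (k + 1) \<in> G"
proof -
  let ?w = "link \<tau> (k + 1)" and ?w' = "link (\<not> \<tau>) (k + 1)"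
  have "link \<sigma> j * link \<tau> k * (?w * ?w') - ?w * ?w' * (link \<sigma> j * link \<tau> k)
      = - (sc \<i> * (link \<sigma> j * ?w))"
    unfolding commutator_products
    using assms by (simp add: acomm_link_link sc_commute mult.assoc)
  moreover have "?w * ?w' \<in> G"
    using assms by (intro G_cartan') simp
  then have "link \<sigma> j * link \<tau> k * (?w * ?w') - ?w * ?w' * (link \<sigma> j * link \<tau> k) \<in> G"
    using assms by (intro G_commutator)
  ultimately have "sc \<i> * (link \<sigma> j * ?w) \<in> G"
    using G_minus by fastforce
  then show ?thesis
    by (simp add: G_scale_iff)
qed

text \<open>The generators supply only the sum of the two mixed products. Their difference is a
  commutator of two Cartan pairs, and sum and difference together separate them.\<close>

lemma G_link_adjacent:
  assumes "1 \<le> j" "j + 1 < N"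
  shows "link \<sigma> j * link \<tau> (j + 1) \<in> G"
proof -
  let ?x = "link True j * link False (j + 1)" and ?y = "link True (j + 1) * link False j"
  have "link True j * link False j * (link True (j + 1) * link False (j + 1))
      - link True (j + 1) * link False (j + 1) * (link True j * link False j) = sc \<i> * (?x - ?y)"
    unfolding commutator_products
    using assms by (simp add: acomm_link_link sc_commute[of "link True _"] mult.assoc
      right_diff_distrib)
  moreover have "link True j * link False j * (link True (j + 1) * link False (j + 1))
      - link True (j + 1) * link False (j + 1) * (link True j * link False j) \<in> G"
    using assms by (intro G_commutator G_cartan) simp_all
  ultimately have diff: "?x - ?y \<in> G"
    using G_scale_iff[of \<i> "?x - ?y"] by simp
  have "?x + ?x \<in> G" "?y + ?y \<in> G"
    using G_add[OF diff G_mixed[OF assms]] G_diff[OF G_mixed[OF assms] diff] by auto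
  then have x: "?x \<in> G" and y: "?y \<in> G"
    by (simp_all add: two_scale G_scale_iff)
  \<comment> \<open>Reversing the factors of \<open>?y\<close> costs only the scalar
    \<open>\<i>\<close>, which lies in \<open>G\<close>.\<close>
  have "link False j * link True (j + 1) = sc \<i> - ?y"
    using assms acomm_link_link[of "j + 1" j True False] by (simp add: acomm_def algebra_simps)
  then have "link False j * link True (j + 1) \<in> G"
    using y by (simp add: G_diff G_sc)
  then show ?thesis
    using x G_simple[OF assms, of \<sigma>] by (cases \<sigma>; cases \<tau>) auto
qed

lemma G_link_less:
  assumes "1 \<le> j" "j < k" "k < N"
  shows "link \<sigma> j * link \<tau> k \<in> G"
  using assms(2,3)
proof (induction k)
  case (Suc k)
  show ?case
  proof (cases "j = k")
    case True
    then show ?thesis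
      using G_link_adjacent[of j] assms(1) Suc.prems by simp
  next
    case False
    then show ?thesis
      using G_link_step[of j k] assms(1) Suc by simp
  qed
qed simp

lemma G_acomm_link: "j \<in> {1..<N} \<Longrightarrow> k \<in> {1..<N} \<Longrightarrow> acomm (link \<sigma> j) (link \<tau> k) \<in> G"
  by (simp add: acomm_link_link G_sc G_zero)

lemma G_link_link:
  assumes "j \<in> {1..<N}" "k \<in> {1..<N}"
  shows "link \<sigma> j * link \<tau> k \<in> G"
proof -
  consider "j < k" | "k < j" | "j = k" "\<tau> = \<sigma>" | "j = k" "\<tau> = (\<not> \<sigma>)"
    by (cases j k rule: linorder_cases) auto
  then show ?thesis
  proof cases
    case 1
    then show ?thesis
      using assms G_link_less by simp
  next
    case 2
    have "link \<sigma> j * link \<tau> k = acomm (link \<sigma> j) (link \<tau> k) - link \<tau> k * link \<sigma> j"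
      by (simp add: acomm_def)
    then show ?thesis
      using assms 2 G_link_less[of k j] by (simp add: G_diff G_acomm_link)
  next
    case 3
    then have "link \<sigma> j * link \<sigma> j + link \<sigma> j * link \<sigma> j = 0"
      using acomm_link_link[OF assms(1) assms(1), of \<sigma> \<sigma>] by (simp add: acomm_def)
    then show ?thesis
      using 3 two_cancel[of "link \<sigma> j * link \<sigma> j"] G_zero by simp
  next
    case 4
    then show ?thesis
      using assms G_cartan' by simp
  qed
qed

section \<open>Even and odd elements built from links\<close>

text \<open>The right \<open>G\<close>-module generated by the links; adding one term at a time
  gives induction over finite sums.\<close>

inductive_set Odd :: "'a set" where
  zero: "0 \<in> Odd"
| add: "k \<in> {1..<N} \<Longrightarrow> g \<in> G \<Longrightarrow> x \<in> Odd \<Longrightarrow> link \<sigma> k * g + x \<in> Odd"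

lemma Odd_add: "x \<in> Odd \<Longrightarrow> y \<in> Odd \<Longrightarrow> x + y \<in> Odd"
  by (induction rule: Odd.induct) (auto simp: add.assoc intro: Odd.intros)

lemma link_G_Odd: "k \<in> {1..<N} \<Longrightarrow> g \<in> G \<Longrightarrow> link \<sigma> k * g \<in> Odd"
  using Odd.add[OF _ _ Odd.zero] by simp

lemma link_Odd_G: "x \<in> Odd \<Longrightarrow> k \<in> {1..<N} \<Longrightarrow> link \<sigma> k * x \<in> G"
  by (induction rule: Odd.induct)
    (simp_all add: distrib_left mult.assoc[symmetric] G_zero G_add G_mult G_link_link)

lemma Odd_scale: "x \<in> Odd \<Longrightarrow> sc a * x \<in> Odd"
  by (induction rule: Odd.induct)
    (auto simp: distrib_left sc_left_commute[symmetric] intro: Odd.intros G_scale)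

text \<open>Kept general in \<open>y\<close> so that it serves the charges and \<open>P\<close>
  alike.\<close>

lemma acomm_Odd:
  assumes "\<And>k \<sigma>. k \<in> {1..<N} \<Longrightarrow> acomm y (link \<sigma> k) = 0" "\<And>g. g \<in> G \<Longrightarrow> y * g = g * y"
    and "x \<in> Odd"
  shows "y * x = - (x * y)"
  using assms(3)
proof (induction rule: Odd.induct)
  case (add k g x \<sigma>)
  have "y * (link \<sigma> k * g) = - (link \<sigma> k * g * y)"
  proof -
    have "y * link \<sigma> k = - (link \<sigma> k * y)"
      using assms(1)[OF add(1), of \<sigma>] by (simp add: acomm_def eq_neg_iff_add_eq_0)
    then show ?thesis
      using assms(2)[OF add(2)] by (metis mult.assoc mult_minus_left)
  qed
  then show ?case
    using add by (simp add: algebra_simps)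
qed simp

lemma charge_Odd: "x \<in> Odd \<Longrightarrow> charge \<sigma> * x = - (x * charge \<sigma>)"
  by (rule acomm_Odd) (simp_all add: acomm_charge_link G_charge)

lemma P_Odd: "x \<in> Odd \<Longrightarrow> P * x = - (x * P)"
  by (rule acomm_Odd) (simp_all add: acomm_P_link G_P)

definition Graded :: "'a set" where
  "Graded = {g + x | g x. g \<in> G \<and> x \<in> Odd}"

lemma Graded_intros: "g \<in> G \<Longrightarrow> g \<in> Graded" "x \<in> Odd \<Longrightarrow> x \<in> Graded"
  unfolding Graded_def using Odd.zero G_zero by (force+)

lemma Graded_add: "x \<in> Graded \<Longrightarrow> y \<in> Graded \<Longrightarrow> x + y \<in> Graded"
proof -
  have "g + x + (h + y) = (g + h) + (x + y)" for g x h y :: 'a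
    by (simp add: algebra_simps)
  then show "x \<in> Graded \<Longrightarrow> y \<in> Graded \<Longrightarrow> x + y \<in> Graded"
    unfolding Graded_def by (blast intro: G_add Odd_add)
qed

lemma Graded_scale: "x \<in> Graded \<Longrightarrow> sc a * x \<in> Graded"
  unfolding Graded_def using G_scale Odd_scale by (force simp: distrib_left)

lemma Graded_minus: "x \<in> Graded \<Longrightarrow> - x \<in> Graded"
  using Graded_scale[of x "-1"] by (simp add: sc_minus sc_1)

lemma Graded_diff: "x \<in> Graded \<Longrightarrow> y \<in> Graded \<Longrightarrow> x - y \<in> Graded"
  using Graded_add[OF _ Graded_minus] by simp

text \<open>Left multiplication by a link exchanges the two summands: it maps \<open>G\<close> into
  \<open>Odd\<close> and \<open>Odd\<close> into \<open>G\<close>.\<close>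

lemma Graded_link: "k \<in> {1..<N} \<Longrightarrow> x \<in> Graded \<Longrightarrow> link \<sigma> k * x \<in> Graded"
  unfolding Graded_def using link_G_Odd link_Odd_G by (force simp: distrib_left add.commute)

section \<open>Normal form with respect to the first site\<close>

abbreviation p :: 'a where "p \<equiv> f False (Suc 0)"
abbreviation q :: 'a where "q \<equiv> f True (Suc 0)"

text \<open>The links together with the two operators at site 1 generate everything; moving \<open>p\<close> and \<open>q\<close>
  to the left gives the following shape.\<close>

definition Spanned :: "'a set" where
  "Spanned = {a + p * b + q * c + p * q * d | a b c d. a \<in> Graded \<and> b \<in> Graded \<and> c \<in> Graded \<and> d \<in>
    Graded}"

lemma Spanned_I: "x = a + p * b + q * c + p * q * d \<Longrightarrow> a \<in> Graded \<Longrightarrow> b \<in> Graded \<Longrightarrow> c \<in> Graded \<Longrightarrow> d \<in>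
  Graded \<Longrightarrow> x \<in> Spanned"
  unfolding Spanned_def by blast

lemma Graded_zero: "0 \<in> Graded"
  by (rule Graded_intros(1)[OF G_zero])

text \<open>Rewrite rules that bring every word in \<open>p\<close> and \<open>q\<close> to a
  combination of \<open>1\<close>, \<open>p\<close>, \<open>q\<close> and \<open>p * q\<close>; the
  versions with \<open>x\<close> apply inside right-nested products.\<close>

lemma pq_rules: "p * p = 0" "q * q = 0" "q * p = 1 - p * q"
  "p * (p * x) = 0" "q * (q * x) = 0" "q * (p * x) = x - p * (q * x)"
proof -
  show *: "p * p = 0" "q * q = 0" "q * p = 1 - p * q"
    using two_cancel[of "p * p"] two_cancel[of "q * q"] car[of 1 1] N
    by (simp_all add: acomm_def eq_diff_eq)
  show "p * (p * x) = 0" "q * (q * x) = 0" "q * (p * x) = x - p * (q * x)"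
    unfolding mult.assoc[symmetric] * by (simp_all add: left_diff_distrib)
qed

lemma Spanned_one: "1 \<in> Spanned"
  by (rule Spanned_I[of _ 1 0 0 0]) (use G_sc[of 1] in \<open>auto intro!: Graded_intros(1) G_zero simp:
    sc_1\<close>)

lemma Spanned_add:
  assumes "x \<in> Spanned" "y \<in> Spanned"
  shows "x + y \<in> Spanned"
proof -
  have *: "a + p * b + q * c + p * q * d + (a' + p * b' + q * c' + p * q * d') =
    (a + a') + p * (b + b') + q * (c + c') + p * q * (d + d')" for a b c d a' b' c' d' :: 'a
    by (simp add: algebra_simps)
  show ?thesis
    using assms unfolding Spanned_def mem_Collect_eq by (metis * Graded_add)
qed

lemma Spanned_scale:
  assumes "x \<in> Spanned"
  shows "sc s * x \<in> Spanned"
proof -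
  have *: "sc s * (a + p * b + q * c + p * q * d) =
    sc s * a + p * (sc s * b) + q * (sc s * c) + p * q * (sc s * d)" for a b c d
    by (simp add: distrib_left sc_left_commute mult.assoc)
  show ?thesis
    using assms unfolding Spanned_def mem_Collect_eq by (metis * Graded_scale)
qed

lemma Spanned_p:
  assumes "x \<in> Spanned"
  shows "p * x \<in> Spanned"
proof -
  obtain a b c d where x: "x = a + p * b + q * c + p * q * d" and "a \<in> Graded" "c \<in> Graded"
    using assms unfolding Spanned_def by blast
  then show ?thesis
    by (intro Spanned_I[of _ 0 a 0 c]) (simp_all add: algebra_simps pq_rules Graded_zero)
qed

lemma Spanned_q:
  assumes "x \<in> Spanned"
  shows "q * x \<in> Spanned"
proof -
  obtain a b c d where x: "x = a + p * b + q * c + p * q * d"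
    and "a \<in> Graded" "b \<in> Graded" "c \<in> Graded" "d \<in> Graded"
    using assms unfolding Spanned_def by blast
  then show ?thesis
    \<comment> \<open>By \<open>q * p = 1 - p * q\<close> the product equals
      \<open>b + q * (a + d) - p * q * b\<close>.\<close>
    by (intro Spanned_I[of _ b 0 "a + d" "- b"])
      (simp_all add: algebra_simps pq_rules Graded_zero Graded_add Graded_minus)
qed

lemma Spanned_link:
  assumes "x \<in> Spanned" "k \<in> {1..<N}"
  shows "link \<sigma> k * x \<in> Spanned"
proof -
  obtain a b c d where x: "x = a + p * b + q * c + p * q * d"
    and *: "a \<in> Graded" "b \<in> Graded" "c \<in> Graded" "d \<in> Graded"
    using assms unfolding Spanned_def by blast
  let ?u = "link \<sigma> k"
  \<comment> \<open>A link passes \<open>p\<close> or \<open>q\<close> up to a scalar, so it reaches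
    the coefficients, where \<open>Graded_link\<close> applies.\<close>
  have "\<exists>s. acomm (f \<tau> (Suc 0)) ?u = sc s" for \<tau>
  proof -
    have "acomm (f \<tau> (Suc 0)) ?u = (if \<tau> \<noteq> \<sigma> \<and> k = 1 then sc 1 else sc 0)"
      using acomm_f_link[of 1 k \<tau> \<sigma>] assms N by (auto simp: sc_0 sc_1)
    then show ?thesis
      by metis
  qed
  then obtain s t where "acomm p ?u = sc s" "acomm q ?u = sc t"
    by metis
  then have "?u * p = sc s - p * ?u" "?u * q = sc t - q * ?u"
    by (auto simp: acomm_def eq_diff_eq add.commute)
  then have up: "?u * (p * y) = sc s * y - p * (?u * y)" and uq: "?u * (q * y) = sc t * y - q *
    (?u * y)" for y
    by (simp_all add: mult.assoc[symmetric] left_diff_distrib)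
  have "?u * x = (?u * a + sc s * b + sc t * c) + p * (- (?u * b) - sc t * d)
      + q * (sc s * d - ?u * c) + p * q * (?u * d)"
    by (simp add: x distrib_left right_diff_distrib mult.assoc up uq sc_left_commute[of p]
      sc_left_commute[of q])
  then show ?thesis
    by (rule Spanned_I) (use * assms(2) in \<open>auto intro!: Graded_link Graded_add Graded_minus
      Graded_diff Graded_scale\<close>)
qed

text \<open>Solving the definition of \<open>link \<sigma> j\<close> for its second fermion
  expresses site \<open>j + 1\<close> through a link and site \<open>j\<close>; the induction starts
  at \<open>p\<close> and \<open>q\<close>.\<close>

lemma Spanned_f:
  assumes "x \<in> Spanned" "j \<in> {1..N}"
  shows "f \<sigma> j * x \<in> Spanned"
  using assms(2)
proof (induction j)
  case (Suc j)
  show ?case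
  proof (cases "j = 0")
    case True
    then show ?thesis
      using Spanned_p[OF assms(1)] Spanned_q[OF assms(1)] by (cases \<sigma>) auto
  next
    case False
    then have j: "j \<in> {1..<N}" "f \<sigma> j * x \<in> Spanned"
      using Suc by auto
    have "f \<sigma> (Suc j) * x = sc (- \<i>) * (link \<sigma> j * x) + sc \<i> * (f \<sigma> j * x)"
      by (simp add: link_def algebra_simps sc_minus)
        (simp add: mult.assoc[symmetric] sc_mult[symmetric] sc_minus sc_1)
    then show ?thesis
      using Spanned_add Spanned_scale Spanned_link[OF assms(1) j(1)] j(2) by metis
  qed
qed simp

theorem commutant_subset:
  assumes "X \<in> Spanned" "\<And>\<sigma>. charge \<sigma> * X = X * charge \<sigma>" "P * X = X * P"
  shows "X \<in> G"
proof -
  obtain a b c d where X: "X = a + p * b + q * c + p * q * d"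
    and Graded: "a \<in> Graded" "b \<in> Graded" "c \<in> Graded" "d \<in> Graded"
    using assms(1) unfolding Spanned_def by blast
  obtain a0 a1 where a: "a = a0 + a1" "a0 \<in> G" "a1 \<in> Odd"
    using Graded(1) unfolding Graded_def by blast
  obtain b0 b1 where b: "b = b0 + b1" "b0 \<in> G" "b1 \<in> Odd"
    using Graded(2) unfolding Graded_def by blast
  obtain c0 c1 where c: "c = c0 + c1" "c0 \<in> G" "c1 \<in> Odd"
    using Graded(3) unfolding Graded_def by blast
  obtain d0 d1 where d: "d = d0 + d1" "d0 \<in> G" "d1 \<in> Odd"
    using Graded(4) unfolding Graded_def by blast
  \<comment> \<open>Counting \<open>p\<close> and \<open>q\<close> as odd, \<open>Y\<close> collects
    the even terms of \<open>X\<close> and \<open>Y'\<close> the odd ones.\<close>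
  define Y where "Y = a0 + p * b1 + q * c1 + p * q * d0"
  define Y' where "Y' = a1 + p * b0 + q * c0 + p * q * d1"
  have XY: "X = Y + Y'"
    by (simp add: X Y_def Y'_def a b c d algebra_simps)
  have Pf: "P * (f \<sigma> (Suc 0) * y) = - (f \<sigma> (Suc 0) * (P * y))" for \<sigma> y
  proof -
    have "P * f \<sigma> (Suc 0) = - (f \<sigma> (Suc 0) * P)"
      using acomm_P[of 1 \<sigma>] N by (simp add: acomm_def eq_neg_iff_add_eq_0)
    then show ?thesis
      by (simp add: mult.assoc[symmetric])
  qed
  have "P * Y = Y * P"
    using a b c d by (simp add: Y_def distrib_left distrib_right mult.assoc Pf P_Odd G_P)
  then have "P * Y' = Y' * P"
    using assms(3) by (simp add: XY distrib_left distrib_right)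
  moreover have "P * Y' = - (Y' * P)"
    using a b c d by (simp add: Y'_def distrib_left distrib_right mult.assoc Pf P_Odd G_P)
  \<comment> \<open>\<open>P\<close> both commutes and anticommutes with \<open>Y'\<close>; the left
    inverse \<open>Q\<close> then removes \<open>P\<close> and leaves \<open>Y' = 0\<close>.\<close>
  ultimately have "P * Y' + P * Y' = 0"
    by (metis add.right_inverse)
  then have "P * Y' = 0"
    by (rule two_cancel)
  then have "Q * P * Y' = 0"
    by (simp add: mult.assoc)
  then have XY: "X = Y"
    by (simp add: QP XY)
  have Zf: "charge \<sigma> * (f \<tau> (Suc 0) * y) = (if \<sigma> = \<tau> then 0 else sc \<i> * y) - f \<tau> (Suc 0) * (charge
    \<sigma> * y)" for \<sigma> \<tau> y
  proof -
    have "charge \<sigma> * f \<tau> (Suc 0) = (if \<sigma> = \<tau> then 0 else sc \<i>) - f \<tau> (Suc 0) * charge \<sigma>"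
      using acomm_charge_f[of 1 \<sigma> \<tau>] N by (simp add: acomm_def eq_diff_eq)
    then show ?thesis
      by (simp add: mult.assoc[symmetric] left_diff_distrib)
  qed
  txt \<open>\<open>charge True\<close> detects \<open>p\<close> and \<open>charge False\<close> detects \<open>q\<close>, so only \<open>a0\<close> survives.\<close>
  have T: "charge True * Y - Y * charge True = sc \<i> * (b1 + q * d0)"
    using a b c d by (simp add: Y_def distrib_left distrib_right right_diff_distrib mult.assoc Zf
      charge_Odd G_charge sc_left_commute[of p] sc_left_commute[of q])
  have F: "charge False * Y - Y * charge False = sc \<i> * (c1 - p * d0)"
    using a b c d by (simp add: Y_def distrib_left distrib_right right_diff_distrib mult.assoc Zf
      charge_Odd G_charge sc_left_commute[of p] sc_left_commute[of q])
  have bd: "b1 + q * d0 = 0" and cd: "c1 - p * d0 = 0"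
    using T F assms(2) by (auto simp: XY sc_cancel)
  \<comment> \<open>The anticommutator of the vanishing element with \<open>charge False\<close>
    isolates \<open>d0\<close>, since \<open>b1\<close> is odd and \<open>q\<close> contributes
    \<open>\<i>\<close>.\<close>
  have "charge False * (b1 + q * d0) + (b1 + q * d0) * charge False = sc \<i> * d0"
    using b d by (simp add: distrib_left distrib_right mult.assoc Zf charge_Odd G_charge)
  then have "d0 = 0"
    by (simp add: bd sc_cancel)
  then show ?thesis
    using XY bd cd a by (simp add: Y_def)
qed

end

section \<open>Matrices as operators on sequences\<close>

typedef endo = "{T :: (nat \<Rightarrow> complex) \<Rightarrow> nat \<Rightarrow> complex.
  (\<forall>v w. T (\<lambda>n. v n + w n) = (\<lambda>n. T v n + T w n)) \<and> (\<forall>a v. T (\<lambda>n. a * v n) = (\<lambda>n. a * T v n))}"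
  by (rule exI[of _ "\<lambda>v. v"]) simp

setup_lifting type_definition_endo

instantiation endo :: ring_1
begin

lift_definition zero_endo :: endo is "\<lambda>v n. 0"
  by simp

lift_definition one_endo :: endo is "\<lambda>v. v"
  by simp

lift_definition plus_endo :: "endo \<Rightarrow> endo \<Rightarrow> endo" is "\<lambda>S T v n. S v n + T v n"
  by (simp add: algebra_simps)

lift_definition minus_endo :: "endo \<Rightarrow> endo \<Rightarrow> endo" is "\<lambda>S T v n. S v n - T v n"
  by (simp add: algebra_simps)

lift_definition uminus_endo :: "endo \<Rightarrow> endo" is "\<lambda>T v n. - T v n"
  by (simp add: algebra_simps)

lift_definition times_endo :: "endo \<Rightarrow> endo \<Rightarrow> endo" is "\<lambda>S T v. S (T v)"
  by simp

instance
proof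
  show "(0::endo) \<noteq> 1"
    by transfer (metis zero_neq_one)
qed (transfer; simp add: algebra_simps)+

end

lift_definition scalar :: "complex \<Rightarrow> endo" is "\<lambda>a v n. a * v n"
  by (simp add: algebra_simps)

lemma complex_algebra_scalar: "complex_algebra scalar"
proof
qed (transfer; simp add: algebra_simps)+

text \<open>Matrices of varying dimension form no instance of \<open>ring_1\<close>. Letting a \<open>d \<times> d\<close> matrix act on
  complex sequences, separately on each block of \<open>d\<close> consecutive entries, embeds \<open>carrier_mat d d\<close>
  into the ring \<open>endo\<close>.\<close>

lift_definition blockwise :: "nat \<Rightarrow> complex mat \<Rightarrow> endo" is
  "\<lambda>d M v n. \<Sum>c<d. M $$ (n mod d, c) * v (d * (n div d) + c)"
  by (simp add: algebra_simps sum.distrib sum_distrib_left)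

context
  fixes d :: nat
  assumes d: "d > 0"
begin

lemma blockwise_one: "blockwise d (1\<^sub>m d) = 1"
proof (transfer fixing: d, intro ext)
  fix v :: "nat \<Rightarrow> complex" and n
  have "(\<Sum>c<d. (1\<^sub>m d) $$ (n mod d, c) * v (d * (n div d) + c)) =
    (\<Sum>c<d. if c = n mod d then v (d * (n div d) + c) else 0)"
    by (rule sum.cong) (use d in auto)
  then show "(\<Sum>c<d. (1\<^sub>m d) $$ (n mod d, c) * v (d * (n div d) + c)) = v n"
    using d by simp
qed

lemma blockwise_add:
  assumes "A \<in> carrier_mat d d" "B \<in> carrier_mat d d"
  shows "blockwise d (A + B) = blockwise d A + blockwise d B"
  using assms d by (transfer fixing: d) (simp add: algebra_simps sum.distrib)

lemma blockwise_smult: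
  assumes "A \<in> carrier_mat d d"
  shows "blockwise d (a \<cdot>\<^sub>m A) = scalar a * blockwise d A"
  using assms d by (transfer fixing: d) (simp add: algebra_simps sum_distrib_left)

lemma blockwise_diff:
  assumes "A \<in> carrier_mat d d" "B \<in> carrier_mat d d"
  shows "blockwise d (A - B) = blockwise d A - blockwise d B"
  using assms d by (transfer fixing: d) (simp add: algebra_simps sum_subtractf)

lemma blockwise_mult:
  assumes "A \<in> carrier_mat d d" "B \<in> carrier_mat d d"
  shows "blockwise d (A * B) = blockwise d A * blockwise d B"
  using assms
proof (transfer fixing: d)
  fix A B :: "complex mat"
  assume AB: "A \<in> carrier_mat d d" "B \<in> carrier_mat d d"
  have "(\<Sum>c<d. (A * B) $$ (n mod d, c) * v (d * (n div d) + c)) =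
    (\<Sum>k<d. A $$ (n mod d, k) * (\<Sum>c<d. B $$ ((d * (n div d) + k) mod d, c)
      * v (d * ((d * (n div d) + k) div d) + c)))" for v :: "nat \<Rightarrow> complex" and n
  proof -
    have "(\<Sum>c<d. (A * B) $$ (n mod d, c) * v (d * (n div d) + c)) =
      (\<Sum>c<d. \<Sum>k<d. A $$ (n mod d, k) * B $$ (k, c) * v (d * (n div d) + c))"
      by (rule sum.cong) (use AB d in \<open>auto simp: scalar_prod_def sum_distrib_right
        lessThan_atLeast0\<close>)
    also have "\<dots> = (\<Sum>k<d. \<Sum>c<d. A $$ (n mod d, k) * B $$ (k, c) * v (d * (n div d) + c))"
      by (rule sum.swap)
    also have "\<dots> = (\<Sum>k<d. A $$ (n mod d, k) * (\<Sum>c<d. B $$ ((d * (n div d) + k) mod d, c)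
      * v (d * ((d * (n div d) + k) div d) + c)))"
      \<comment> \<open>For \<open>k < d\<close> the index \<open>d * (n div d) + k\<close> stays in
        the block of \<open>n\<close> and has remainder \<open>k\<close>.\<close>
      by (rule sum.cong) (use d in \<open>auto simp: sum_distrib_left mult.assoc\<close>)
    finally show ?thesis .
  qed
  then show "(\<lambda>v n. \<Sum>c<d. (A * B) $$ (n mod d, c) * v (d * (n div d) + c)) =
    (\<lambda>v n. \<Sum>k<d. A $$ (n mod d, k) * (\<Sum>c<d. B $$ ((d * (n div d) + k) mod d, c)
      * v (d * ((d * (n div d) + k) div d) + c)))"
    by (intro ext)
qed

lemma blockwise_eq_iff:
  assumes "A \<in> carrier_mat d d" "B \<in> carrier_mat d d"
  shows "blockwise d A = blockwise d B \<longleftrightarrow> A = B"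
proof
  assume eq: "blockwise d A = blockwise d B"
  show "A = B"
  proof (rule eq_matI)
    fix i j assume "i < dim_row B" "j < dim_col B"
    then have ij: "i < d" "j < d"
      using assms by auto
    \<comment> \<open>The unit sequence at \<open>j\<close> lies in block 0, as does
      \<open>i\<close>, so applying a matrix to it reads off the entry
      \<open>(i, j)\<close>.\<close>
    define v where "v = (\<lambda>n. of_bool (n = j) :: complex)"
    have "(\<Sum>c<d. M $$ (i mod d, c) * v (d * (i div d) + c)) = M $$ (i, j)" for M
      using ij by (simp add: v_def if_distrib cong: if_cong)
    moreover from eq have "(\<Sum>c<d. A $$ (i mod d, c) * v (d * (i div d) + c)) =
        (\<Sum>c<d. B $$ (i mod d, c) * v (d * (i div d) + c))"
      by (transfer fixing: d i v A B) metis
    ultimately show "A $$ (i, j) = B $$ (i, j)"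
      by simp
  qed (use assms in auto)
qed simp

end

section \<open>Jordan--Wigner operators\<close>

text \<open>If \<open>g c < d\<close>, the basis vector \<open>c\<close> goes to \<open>a c\<close>
  times the basis vector \<open>g c\<close>. Products thus reduce to composing index maps and
  multiplying coefficients.\<close>

definition mono_mat :: "nat \<Rightarrow> (nat \<Rightarrow> complex) \<Rightarrow> (nat \<Rightarrow> nat) \<Rightarrow> complex mat" where
  "mono_mat d a g = mat d d (\<lambda>(r, c). if r = g c then a c else 0)"

lemma mono_mat_carrier [simp]: "mono_mat d a g \<in> carrier_mat d d"
  by (simp add: mono_mat_def)

lemma mono_mat_dim [simp]: "dim_row (mono_mat d a g) = d" "dim_col (mono_mat d a g) = d"
  by (simp_all add: mono_mat_def)

lemma mono_mat_index [simp]: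
  "r < d \<Longrightarrow> c < d \<Longrightarrow> mono_mat d a g $$ (r, c) = (if r = g c then a c else 0)"
  by (simp add: mono_mat_def)

lemma mono_mat_mult:
  assumes "\<And>c. c < d \<Longrightarrow> h c < d"
  shows "mono_mat d a g * mono_mat d b h = mono_mat d (\<lambda>c. a (h c) * b c) (\<lambda>c. g (h c))"
proof (rule eq_matI)
  fix r c assume "r < dim_row (mono_mat d (\<lambda>c. a (h c) * b c) (\<lambda>c. g (h c)))"
    "c < dim_col (mono_mat d (\<lambda>c. a (h c) * b c) (\<lambda>c. g (h c)))"
  then have rc: "r < d" "c < d"
    by simp_all
  then have "(mono_mat d a g * mono_mat d b h) $$ (r, c) =
      (\<Sum>k<d. (if r = g k then a k else 0) * (if k = h c then b c else 0))"
    by (simp add: scalar_prod_def lessThan_atLeast0)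
  also have "\<dots> = (\<Sum>k<d. if k = h c then (if r = g k then a k else 0) * b c else 0)"
    by (rule sum.cong) auto
  finally show "(mono_mat d a g * mono_mat d b h) $$ (r, c) =
      mono_mat d (\<lambda>c. a (h c) * b c) (\<lambda>c. g (h c)) $$ (r, c)"
    using rc assms by simp
qed simp_all

lemma mono_mat_cong:
  "(\<And>c. c < d \<Longrightarrow> a c = b c) \<Longrightarrow> (\<And>c. c < d \<Longrightarrow> g c = h c) \<Longrightarrow> mono_mat d a g = mono_mat d b h"
  by (rule eq_matI) auto

lemma mono_mat_smult: "s \<cdot>\<^sub>m mono_mat d a g = mono_mat d (\<lambda>c. s * a c) g"
  by (rule eq_matI) auto

section \<open>Basis states as bit strings\<close>

lemma bitN_eq: "bitN N j n = of_bool (bit n (N - j))"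
  by (simp add: bitN_def bit_iff_odd odd_iff_mod_2_eq_one)

definition flip :: "nat \<Rightarrow> nat \<Rightarrow> nat \<Rightarrow> nat" where
  "flip N j n = flip_bit (N - j) n"

lemma bit_flip [simp]: "bit (flip N j n) m \<longleftrightarrow> (bit n m \<noteq> (m = N - j))"
  by (auto simp: flip_def bit_flip_bit_iff)

lemma flip_less [simp]:
  assumes "j \<in> {1..N}" "n < 2 ^ N"
  shows "flip N j n < 2 ^ N"
proof -
  have "\<not> N \<le> N - j"
    using assms by auto
  then have "take_bit N (flip N j n) = flip N j n"
    using assms by (simp add: flip_def take_bit_flip_bit_eq take_bit_nat_eq_self)
  then show ?thesis
    by (metis take_bit_nat_less_exp)
qed

lemma flip_flip [simp]: "flip N j (flip N j n) = n"
  by (rule bit_eqI) auto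

lemma flip_commute: "flip N j (flip N k n) = flip N k (flip N j n)"
  by (rule bit_eqI) auto

lemma not_bit_less: 
  assumes "(n::nat) < 2 ^ N" "N \<le> m"
  shows "\<not> bit n m"
  using assms by (metis bit_take_bit_iff leD take_bit_nat_eq_self)

lemma basis_eqI:
  assumes "r < 2 ^ N" "c < 2 ^ N" "\<And>j. j \<in> {1..N} \<Longrightarrow> bit r (N - j) = bit c (N - j)"
  shows "r = (c :: nat)"
proof (rule bit_eqI)
  fix m
  show "bit r m \<longleftrightarrow> bit c m"
  proof (cases "m < N")
    case True
    then show ?thesis
      using assms(3)[of "N - m"] by simp
  next
    case False
    then show ?thesis
      using not_bit_less[OF assms(1)] not_bit_less[OF assms(2)] by simp
  qed
qed

text \<open>Only the digit at site \<open>j\<close> is free, so \<open>site_op\<close> connects a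
  basis state just with itself and its flip.\<close>

lemma bits_agree_iff:
  assumes "r < 2 ^ N" "c < 2 ^ N" "j \<in> {1..N}"
  shows "(\<forall>k\<in>{1..N} - {j}. bitN N k r = bitN N k c) \<longleftrightarrow> r = c \<or> r = flip N j c"
proof
  assume *: "\<forall>k\<in>{1..N} - {j}. bitN N k r = bitN N k c"
  show "r = c \<or> r = flip N j c"
  proof (cases "bit r (N - j) = bit c (N - j)")
    case True
    have "r = c"
      by (rule basis_eqI[of _ N]) (use assms * True in \<open>auto simp: bitN_eq of_bool_eq_iff\<close>)
    then show ?thesis ..
  next
    case False
    have "r = flip N j c"
    proof (rule basis_eqI[of _ N])
      fix k assume "k \<in> {1..N}"
      then show "bit r (N - k) = bit (flip N j c) (N - k)"
        using * False assms(3) by (cases "k = j") (auto simp: bitN_eq of_bool_eq_iff)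
    qed (use assms in auto)
    then show ?thesis ..
  qed
qed (use assms in \<open>auto simp: bitN_eq\<close>)

section \<open>Jordan--Wigner signs and ladder operators\<close>

text \<open>Digit 0 (\<open>zval\<close> equal to 1) contributes -1, so this is the parity of the
  number of occupied sites before \<open>j\<close>.\<close>

definition jw_sign :: "nat \<Rightarrow> nat \<Rightarrow> nat \<Rightarrow> complex" where
  "jw_sign N j x = (\<Prod>k\<in>{1..<j}. - of_int (zval N k x))"

lemma jw_sign_square: "jw_sign N j x * jw_sign N j x = 1"
  by (simp add: jw_sign_def prod.distrib[symmetric] zval_def prod.neutral)

lemma zval_flip:
  "j \<in> {1..N} \<Longrightarrow> k \<in> {1..N} \<Longrightarrow> zval N k (flip N j x) = (if j = k then - 1 else 1) * zval N k x"
  by (auto simp: zval_def bitN_eq)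

lemma prod_zval_flip:
  assumes "k \<in> {1..N}" "J \<subseteq> {1..N}"
  shows "(\<Prod>i\<in>J. s * of_int (zval N i (flip N k x))) =
    (if k \<in> J then - 1 else 1) * (\<Prod>i\<in>J. s * of_int (zval N i x) :: complex)"
proof -
  have "(\<Prod>i\<in>J. s * of_int (zval N i (flip N k x))) =
      (\<Prod>i\<in>J. (if i = k then - 1 else 1) * (s * of_int (zval N i x) :: complex))"
    by (rule prod.cong) (use assms in \<open>auto simp: zval_flip\<close>)
  then show ?thesis
    using finite_subset[OF assms(2)] by (simp add: prod.distrib)
qed

text \<open>Only sites strictly before \<open>j\<close> enter the sign. This asymmetry makes ladder
  operators at different sites anticommute.\<close>

lemma jw_sign_flip:
  assumes "k \<in> {1..N}" "j \<in> {1..N}"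
  shows "jw_sign N j (flip N k x) = (if k < j then - 1 else 1) * jw_sign N j x"
proof -
  have "{1..<j} \<subseteq> {1..N}"
    using assms by auto
  from prod_zval_flip[OF assms(1) this, of "- 1" x] show ?thesis
    using assms by (simp add: jw_sign_def)
qed

text \<open>The prefactor supplies one \<open>\<i>\<close> per site, and
  \<open>\<i> * \<i> powi z = - z\<close> for \<open>z\<close> equal to 1 or -1.\<close>

lemma jw_sign_powi: "\<i> ^ (j - 1) * \<i> powi (\<Sum>k\<in>{1..<j}. zval N k x) = jw_sign N j x"
proof (induction j)
  case (Suc j)
  show ?case
  proof (cases "j = 0")
    case False
    then have "\<i> ^ j = \<i> ^ (j - 1) * \<i>"
      by (cases j) auto
    then have "\<i> ^ j * \<i> powi (\<Sum>k\<in>{1..<Suc j}. zval N k x) =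
        (\<i> ^ (j - 1) * \<i> powi (\<Sum>k\<in>{1..<j}. zval N k x)) * (\<i> * \<i> powi zval N j x)"
      using False by (simp add: power_int_add)
    also have "\<i> * \<i> powi zval N j x = - of_int (zval N j x)"
      by (simp add: zval_def)
    finally show ?thesis
      using False unfolding Suc by (simp add: jw_sign_def)
  qed (simp add: jw_sign_def)
qed (simp add: jw_sign_def)

lemma jw_sign_powi': "\<i> powi (- int j + 1) * \<i> powi (- (\<Sum>k\<in>{1..<j}. zval N k x)) = jw_sign N j x"
  if "j \<ge> 1"
proof -
  let ?s = "\<Sum>k\<in>{1..<j}. zval N k x"
  have "- int j + 1 = - int (j - 1)"
    using that by simp
  then have "\<i> powi (- int j + 1) * \<i> powi (- ?s) = inverse (\<i> ^ (j - 1) * \<i> powi ?s)"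
    by (simp only: power_int_minus inverse_mult_distrib power_int_of_nat)
  also have "\<dots> = jw_sign N j x"
    unfolding jw_sign_powi using jw_sign_square[of N j x] by (rule inverse_unique)
  finally show ?thesis .
qed

text \<open>\<open>ladder N True j\<close> and \<open>ladder N False j\<close> are the Jordan--Wigner operators
  \<open>cdag N j\<close> and \<open>cann N j\<close>; the digit 1, being the second basis vector, is the empty site.\<close>

definition ladder :: "nat \<Rightarrow> bool \<Rightarrow> nat \<Rightarrow> complex mat" where
  "ladder N \<tau> j = mono_mat (2 ^ N) (\<lambda>x. of_bool (bit x (N - j) = \<tau>) * jw_sign N j x) (flip N j)"

lemma ladder_carrier [simp]: "ladder N \<tau> j \<in> carrier_mat (2 ^ N) (2 ^ N)"
  by (simp add: ladder_def)

lemma jw_string_eq: "jw_string N e j = mono_mat (2 ^ N) (\<lambda>x. \<i> powi (e * (\<Sum>k\<in>{1..<j}. zval N k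
  x))) (\<lambda>x. x)"
  by (rule eq_matI) (auto simp: jw_string_def)

lemma site_op_dim [simp]: "dim_row (site_op N j A) = 2 ^ N" "dim_col (site_op N j A) = 2 ^ N"
  by (simp_all add: site_op_def)

lemma site_op_index:
  assumes "r < 2 ^ N" "c < 2 ^ N" "j \<in> {1..N}"
  shows "site_op N j A $$ (r, c) = (if r = c \<or> r = flip N j c
    then A $$ (of_bool (bit r (N - j)), of_bool (bit c (N - j))) else 0)"
proof -
  have "site_op N j A $$ (r, c) = (if \<forall>k\<in>{1..N} - {j}. bitN N k r = bitN N k c
      then A $$ (bitN N j r, bitN N j c) else 0)"
    using assms by (simp add: site_op_def)
  then show ?thesis
    by (simp only: bits_agree_iff[OF assms] bitN_eq[of N j])
qed

lemma site_op_sigma_plus: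
  assumes "j \<in> {1..N}"
  shows "site_op N j sigma_plus = mono_mat (2 ^ N) (\<lambda>x. of_bool (bit x (N - j))) (flip N j)"
  by (rule eq_matI) (use assms in \<open>auto simp: site_op_index sigma_plus_def\<close>)

lemma site_op_sigma_minus:
  assumes "j \<in> {1..N}"
  shows "site_op N j sigma_minus = mono_mat (2 ^ N) (\<lambda>x. of_bool (\<not> bit x (N - j))) (flip N j)"
  by (rule eq_matI) (use assms in \<open>auto simp: site_op_index sigma_minus_def\<close>)

lemma site_op_sigma_z:
  assumes "j \<in> {1..N}"
  shows "site_op N j sigma_z = mono_mat (2 ^ N) (\<lambda>x. of_int (zval N j x)) (\<lambda>x. x)"
  by (rule eq_matI) (use assms in \<open>auto simp: site_op_index sigma_z_def zval_def bitN_eq\<close>)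

lemma cdag_eq_ladder:
  assumes "j \<in> {1..N}"
  shows "cdag N j = ladder N True j"
proof -
  \<comment> \<open>The string acts after \<open>sigma_plus\<close> and sees the flipped state, but
    site \<open>j\<close> is outside its range.\<close>
  have "\<i> ^ (j - 1) * \<i> powi (\<Sum>k\<in>{1..<j}. zval N k (flip N j x)) = jw_sign N j x" for x
    using assms by (simp only: jw_sign_powi jw_sign_flip) simp
  then show ?thesis
    unfolding cdag_def ladder_def jw_string_eq site_op_sigma_plus[OF assms]
    using assms
    by (subst mono_mat_mult, simp, unfold mono_mat_smult, intro mono_mat_cong)
      (simp_all add: of_bool_def)
qed

lemma cann_eq_ladder:
  assumes "j \<in> {1..N}"
  shows "cann N j = ladder N False j"
proof -
  have "\<i> powi (- int j + 1) * \<i> powi (- (\<Sum>k\<in>{1..<j}. zval N k (flip N j x))) = jw_sign N j x" for x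
    using assms jw_sign_powi'[of j] jw_sign_flip[OF assms assms] by simp
  then show ?thesis
    unfolding cann_def ladder_def jw_string_eq site_op_sigma_minus[OF assms]
    using assms
    by (subst mono_mat_mult, simp, unfold mono_mat_smult, intro mono_mat_cong)
      (simp_all add: of_bool_def)
qed

lemma rhoK_eq:
  "rhoK N = mono_mat (2 ^ N) (\<lambda>x. \<i> ^ N * (\<Prod>k\<in>{1..N}. of_int (zval N k x))) (\<lambda>x. x)"
proof -
  have "mprod (2 ^ N) (map (\<lambda>k. site_op N k sigma_z) ks) =
      mono_mat (2 ^ N) (\<lambda>x. \<Prod>k\<leftarrow>ks. of_int (zval N k x)) (\<lambda>x. x)" if "set ks \<subseteq> {1..N}" for ks
    using that
  proof (induction ks)
    case Nil
    show ?case
      by (rule eq_matI) (auto simp: mprod_def)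
  next
    case (Cons k ks)
    then show ?case
      by (simp add: mprod_def site_op_sigma_z mono_mat_mult)
  qed
  from this[of "[1..<N+1]"] show ?thesis
    by (simp add: rhoK_def mono_mat_smult prod.distinct_set_conv_list[symmetric]
      atLeastLessThanSuc_atLeastAtMost
        del: upt_Suc)
qed

lemma ladder_car:
  assumes "j \<in> {1..N}" "k \<in> {1..N}"
  shows "ladder N \<sigma> j * ladder N \<tau> k + ladder N \<tau> k * ladder N \<sigma> j =
    (of_bool (j = k \<and> \<sigma> \<noteq> \<tau>) :: complex) \<cdot>\<^sub>m 1\<^sub>m (2 ^ N)"
proof (rule eq_matI)
  fix r c assume "r < dim_row ((of_bool (j = k \<and> \<sigma> \<noteq> \<tau>) :: complex) \<cdot>\<^sub>m 1\<^sub>m (2 ^ N))"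
    "c < dim_col ((of_bool (j = k \<and> \<sigma> \<noteq> \<tau>) :: complex) \<cdot>\<^sub>m 1\<^sub>m (2 ^ N))"
  then have rc: "r < 2 ^ N" "c < 2 ^ N"
    by auto
  have eq: "N - j = N - k \<longleftrightarrow> j = k" "N - k = N - j \<longleftrightarrow> j = k"
    using assms by auto
  show "(ladder N \<sigma> j * ladder N \<tau> k + ladder N \<tau> k * ladder N \<sigma> j) $$ (r, c) =
    ((of_bool (j = k \<and> \<sigma> \<noteq> \<tau>) :: complex) \<cdot>\<^sub>m 1\<^sub>m (2 ^ N)) $$ (r, c)"
    using assms rc jw_sign_square[of N k c]
    by (auto simp: ladder_def mono_mat_mult jw_sign_flip flip_commute[of N k j] eq of_bool_def)
qed (auto simp: ladder_def)

text \<open>Flipping a single site negates the product of all \<open>zval\<close> factors.\<close>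

lemma rhoK_ladder:
  assumes "j \<in> {1..N}"
  shows "rhoK N * ladder N \<tau> j + ladder N \<tau> j * rhoK N = 0\<^sub>m (2 ^ N) (2 ^ N)"
  by (rule eq_matI) (use assms prod_zval_flip[of j N "{1..N}" 1] in
    \<open>auto simp: rhoK_eq ladder_def mono_mat_mult\<close>)

lemma rhoK_square: "((-1) ^ N \<cdot>\<^sub>m rhoK N) * rhoK N = 1\<^sub>m (2 ^ N)"
proof -
  have "(\<Prod>k\<in>{1..N}. of_int (zval N k x)) * (\<Prod>k\<in>{1..N}. of_int (zval N k x)) = (1 :: complex)" for x
    by (simp add: prod.distrib[symmetric] zval_def prod.neutral)
  moreover have "\<i> ^ N * \<i> ^ N = (-1) ^ N"
    by (simp add: power_mult_distrib[symmetric])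
  ultimately have "(-1) ^ N * (\<i> ^ N * (\<Prod>k\<in>{1..N}. of_int (zval N k x))) *
     (\<i> ^ N * (\<Prod>k\<in>{1..N}. of_int (zval N k x))) = (1 :: complex)" for x
    by (simp add: ac_simps) (metis mult.assoc mult.right_neutral power_add power_mult_distrib
      mult_minus1 minus_minus power_one)
  then show ?thesis
    unfolding rhoK_eq mono_mat_smult by (subst mono_mat_mult, simp) (rule eq_matI, auto)
qed

text \<open>Products of ladder operators project onto a single basis state, further ladder operators
  move its row index, and the resulting matrix units span everything.\<close>

lemma ladder_closed_full:
  assumes carrier: "S \<subseteq> carrier_mat (2 ^ N) (2 ^ N)"
    and one: "1\<^sub>m (2 ^ N) \<in> S"
    and add: "\<And>A B. A \<in> S \<Longrightarrow> B \<in> S \<Longrightarrow> A + B \<in> S"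
    and smult: "\<And>a A. A \<in> S \<Longrightarrow> a \<cdot>\<^sub>m A \<in> S"
    and ladder: "\<And>\<tau> j A. j \<in> {1..N} \<Longrightarrow> A \<in> S \<Longrightarrow> ladder N \<tau> j * A \<in> S"
  shows "S = carrier_mat (2 ^ N) (2 ^ N)"
proof -
  define E where "E y x = mono_mat (2 ^ N) (\<lambda>c. of_bool (c = x)) (\<lambda>_. y)" for y x
  have diagonal: "mono_mat (2 ^ N) (\<lambda>c. of_bool (\<forall>j\<in>J. bit c (N - j) = bit x (N - j))) (\<lambda>c. c) \<in> S"
    if "finite J" "J \<subseteq> {1..N}" for J x
    using that
  proof (induction J)
    case empty
    have "mono_mat (2 ^ N) (\<lambda>c. 1) (\<lambda>c. c) = 1\<^sub>m (2 ^ N)"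
      by (rule eq_matI) auto
    then show ?case
      using one by simp
  next
    case (insert j J)
    let ?D = "mono_mat (2 ^ N) (\<lambda>c. of_bool (\<forall>j\<in>J. bit c (N - j) = bit x (N - j))) (\<lambda>c. c)"
    have j: "j \<in> {1..N}" and "?D \<in> S"
      using insert by auto
    \<comment> \<open>The two ladder operators together project onto states whose digit at
      \<open>j\<close> agrees with that of \<open>x\<close>; their signs cancel.\<close>
    then have "ladder N (\<not> bit x (N - j)) j * (ladder N (bit x (N - j)) j * ?D) \<in> S"
      by (intro ladder)
    also have "ladder N (\<not> bit x (N - j)) j * (ladder N (bit x (N - j)) j * ?D) =
        mono_mat (2 ^ N) (\<lambda>c. of_bool (\<forall>j\<in>insert j J. bit c (N - j) = bit x (N - j))) (\<lambda>c. c)"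
      unfolding ladder_def using j jw_sign_square[of N j]
      by (auto simp: mono_mat_mult jw_sign_flip intro!: mono_mat_cong)
    finally show ?case .
  qed
  have unit_diagonal: "E x x \<in> S" if "x < 2 ^ N" for x
  proof -
    have "c = x" if "c < 2 ^ N" "\<forall>j\<in>{1..N}. bit c (N - j) = bit x (N - j)" for c
      using that \<open>x < 2 ^ N\<close> by (intro basis_eqI[of c N x]) auto
    then have "E x x = mono_mat (2 ^ N) (\<lambda>c. of_bool (\<forall>j\<in>{1..N}. bit c (N - j) = bit x (N - j)))
      (\<lambda>c. c)"
      unfolding E_def by (intro eq_matI) auto
    then show ?thesis
      using diagonal[of "{1..N}" x] by simp
  qed
  have unit_step: "E (flip N j y) x \<in> S" if "E y x \<in> S" "y < 2 ^ N" "j \<in> {1..N}" for j y x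
  proof -
    have "jw_sign N j y \<cdot>\<^sub>m (ladder N (bit y (N - j)) j * E y x) \<in> S"
      using that by (intro smult ladder)
    also have "jw_sign N j y \<cdot>\<^sub>m (ladder N (bit y (N - j)) j * E y x) = E (flip N j y) x"
      unfolding ladder_def E_def using that jw_sign_square[of N j y]
      by (auto simp: mono_mat_mult mono_mat_smult intro!: mono_mat_cong)
    finally show ?thesis .
  qed
  \<comment> \<open>Induction on a set \<open>J\<close> of sites outside which \<open>y\<close> and
    \<open>x\<close> agree, flipping one digit of \<open>y\<close> at a time.\<close>
  have unit: "E y x \<in> S" if "finite J" "J \<subseteq> {1..N}" "x < 2 ^ N" "y < 2 ^ N"
    "\<And>j. j \<in> {1..N} - J \<Longrightarrow> bit y (N - j) = bit x (N - j)" for J y x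
    using that
  proof (induction J arbitrary: y)
    case empty
    then have "y = x"
      by (intro basis_eqI[of y N x]) auto
    then show ?case
      using unit_diagonal empty by simp
  next
    case (insert j J)
    show ?case
    proof (cases "bit y (N - j) = bit x (N - j)")
      case True
      then show ?thesis
        using insert by (metis Diff_iff insert_iff insert_subset)
    next
      case False
      have j: "j \<in> {1..N}"
        using insert by auto
      have "E (flip N j y) x \<in> S"
      proof (rule insert.IH)
        fix k assume "k \<in> {1..N} - J"
        then show "bit (flip N j y) (N - k) = bit x (N - k)"
          using insert.prems(4)[of k] False j by (cases "k = j") auto
      qed (use insert.prems j in auto)
      then show ?thesis
        using unit_step[of "flip N j y" x j] insert.prems j by simp
    qed
  qed
  have "A \<in> S" if A: "A \<in> carrier_mat (2 ^ N) (2 ^ N)" for A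
  proof -
    have "mat (2 ^ N) (2 ^ N) (\<lambda>rc. if rc \<in> K then A $$ rc else 0) \<in> S"
      if "finite K" "K \<subseteq> {..<2 ^ N} \<times> {..<2 ^ N}" for K
      using that
    proof (induction K)
      case empty
      have "mat (2 ^ N) (2 ^ N) (\<lambda>rc. 0) = (0 :: complex) \<cdot>\<^sub>m 1\<^sub>m (2 ^ N)"
        by (rule eq_matI) auto
      then show ?case
        using smult[OF one, of 0] by simp
    next
      case (insert rc K)
      obtain r c where rc: "rc = (r, c)" "r < 2 ^ N" "c < 2 ^ N"
        using insert by auto
      have "mat (2 ^ N) (2 ^ N) (\<lambda>rc. if rc \<in> K then A $$ rc else 0) + A $$ rc \<cdot>\<^sub>m E r c \<in> S"
        using insert rc unit[of "{1..N}" c r] by (intro add smult) auto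
      also have "mat (2 ^ N) (2 ^ N) (\<lambda>rc. if rc \<in> K then A $$ rc else 0) + A $$ rc \<cdot>\<^sub>m E r c =
          mat (2 ^ N) (2 ^ N) (\<lambda>x. if x \<in> insert rc K then A $$ x else 0)"
        unfolding E_def by (rule eq_matI) (use insert rc in auto)
      finally show ?case .
    qed
    from this[of "{..<2 ^ N} \<times> {..<2 ^ N}"]
    have "mat (2 ^ N) (2 ^ N) (\<lambda>rc. if rc \<in> {..<2 ^ N} \<times> {..<2 ^ N} then A $$ rc else 0) \<in> S"
      by simp
    also have "mat (2 ^ N) (2 ^ N) (\<lambda>rc. if rc \<in> {..<2 ^ N} \<times> {..<2 ^ N} then A $$ rc else 0) = A"
      by (rule eq_matI) (use A in auto)
    finally show ?thesis .
  qed
  then show ?thesis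
    using carrier by auto
qed

section \<open>The centralizer\<close>

lemma msum_carrier [simp]: "msum d F A \<in> carrier_mat d d"
  by (simp add: msum_def)

lemma blockwise_msum:
  assumes "d > 0" "finite A" "\<And>k. k \<in> A \<Longrightarrow> F k \<in> carrier_mat d d"
  shows "blockwise d (msum d F A) = (\<Sum>k\<in>A. blockwise d (F k))"
  using assms(2,3)
proof (induction A)
  case empty
  have "msum d F {} = 0 \<cdot>\<^sub>m 1\<^sub>m d"
    by (rule eq_matI) (auto simp: msum_def)
  then show ?case
    using assms(1) by (simp add: blockwise_smult complex_algebra.sc_0[OF complex_algebra_scalar])
next
  case (insert k A)
  then have "msum d F (insert k A) = F k + msum d F A"
    by (intro eq_matI) (auto simp: msum_def)
  then show ?case
    using insert assms(1) by (simp add: blockwise_add)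
qed

abbreviation ladder_op :: "nat \<Rightarrow> bool \<Rightarrow> nat \<Rightarrow> endo" where
  "ladder_op N \<tau> j \<equiv> blockwise (2 ^ N) (ladder N \<tau> j)"

abbreviation parity_op :: "nat \<Rightarrow> endo" where
  "parity_op N \<equiv> blockwise (2 ^ N) (rhoK N)"

abbreviation parity_inv :: "nat \<Rightarrow> endo" where
  "parity_inv N \<equiv> blockwise (2 ^ N) ((-1) ^ N \<cdot>\<^sub>m rhoK N)"

lemma rhoK_carrier [simp]: "rhoK N \<in> carrier_mat (2 ^ N) (2 ^ N)"
  by (simp add: rhoK_eq)

lemma parity_inv: "parity_inv N * parity_op N = 1" "parity_op N * parity_inv N = 1"
proof -
  show *: "parity_inv N * parity_op N = 1"
    using rhoK_square[of N] by (simp add: blockwise_mult[symmetric] blockwise_one)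
  then show "parity_op N * parity_inv N = 1"
    by (simp add: blockwise_smult complex_algebra.sc_left_commute[OF complex_algebra_scalar]
      mult.assoc)
qed

lemma fermions_ladder:
  assumes "N \<ge> 1"
  shows "fermions scalar N (ladder_op N) (parity_op N) (parity_inv N)"
proof -
  interpret complex_algebra scalar
    by (rule complex_algebra_scalar)
  show ?thesis
  proof
    fix j k \<sigma> \<tau>
    assume "j \<in> {1..N}" "k \<in> {1..N}"
    then show "acomm (ladder_op N \<sigma> j) (ladder_op N \<tau> k) = of_bool (j = k \<and> \<sigma> \<noteq> \<tau>)"
      by (simp add: acomm_def blockwise_mult[symmetric] blockwise_add[symmetric] ladder_car
          mult_carrier_mat[of _ "2 ^ N" "2 ^ N"] blockwise_smult blockwise_one sc_0 sc_1)
  next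
    fix j \<tau>
    assume "j \<in> {1..N}"
    moreover have "0\<^sub>m (2 ^ N) (2 ^ N) = (0 :: complex) \<cdot>\<^sub>m 1\<^sub>m (2 ^ N)"
      by (rule eq_matI) auto
    ultimately have "acomm (parity_op N) (ladder_op N \<tau> j) = blockwise (2 ^ N) (0 \<cdot>\<^sub>m 1\<^sub>m (2 ^ N))"
      by (simp add: acomm_def blockwise_mult[symmetric] blockwise_add[symmetric] rhoK_ladder
          mult_carrier_mat[of _ "2 ^ N" "2 ^ N"])
    then show "acomm (parity_op N) (ladder_op N \<tau> j) = 0"
      by (simp add: blockwise_smult sc_0)
  qed (use assms in \<open>simp_all add: parity_inv\<close>)
qed

lemma blockwise_commute_iff:
  assumes "d > 0" "A \<in> carrier_mat d d" "B \<in> carrier_mat d d"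
  shows "A * B - B * A = 0\<^sub>m d d \<longleftrightarrow> blockwise d A * blockwise d B = blockwise d B * blockwise d A"
proof -
  have "A * B - B * A = 0\<^sub>m d d \<longleftrightarrow> A * B = B * A"
  proof
    assume *: "A * B - B * A = 0\<^sub>m d d"
    show "A * B = B * A"
    proof (rule eq_matI)
      fix i j assume "i < dim_row (B * A)" "j < dim_col (B * A)"
      then show "(A * B) $$ (i, j) = (B * A) $$ (i, j)"
        using arg_cong[OF *, of "\<lambda>M. M $$ (i, j)"] assms by simp
    qed (use assms in auto)
  qed (use assms in auto)
  also have "\<dots> \<longleftrightarrow> blockwise d (A * B) = blockwise d (B * A)"
    using assms by (intro blockwise_eq_iff[symmetric]) auto
  finally show ?thesis
    using assms by (simp add: blockwise_mult)
qed

theorem mainTheorem1: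
  fixes N :: nat
  assumes "N \<ge> 2"
  shows "centralizer N = gen_alg (2^N) (generators N)"
proof -
  let ?d = "2 ^ N :: nat"
  let ?f = "ladder_op N" and ?P = "parity_op N" and ?bw = "blockwise ?d"
  interpret fermions scalar N ?f ?P "parity_inv N"
    using assms by (intro fermions_ladder) simp
  have carrier: "A + B \<in> carrier_mat ?d ?d" "A - B \<in> carrier_mat ?d ?d" "A * B \<in> carrier_mat ?d ?d"
      "a \<cdot>\<^sub>m A \<in> carrier_mat ?d ?d"
    if "A \<in> carrier_mat ?d ?d" "B \<in> carrier_mat ?d ?d" for A B :: "complex mat" and a
    using that by auto
  note bw = blockwise_add blockwise_diff blockwise_mult blockwise_smult blockwise_one
  have sites: "cdag N j = ladder N True j" "cann N j = ladder N False j" if "j \<in> {1..N}" for j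
    using that by (simp_all add: cdag_eq_ladder cann_eq_ladder)

  have rhoF: "rhoF N \<in> carrier_mat ?d ?d" "?bw (rhoF N) = scalar (- \<i>) * charge False"
  proof -
    show "rhoF N \<in> carrier_mat ?d ?d"
      by (simp add: rhoF_def)
    have "?bw (rhoF N) = (\<Sum>j\<in>{1..N}. scalar (\<i> ^ (j - 1)) * ?f False j)"
      unfolding rhoF_def by (subst blockwise_msum) (simp_all add: sites blockwise_smult)
    also have "\<dots> = (\<Sum>j\<in>{1..N}. scalar (- \<i>) * (scalar (\<i> ^ j) * ?f False j))"
    proof (rule sum.cong)
      fix j assume "j \<in> {1..N}"
      \<comment> \<open>\<open>j \<ge> 1\<close> matters: with truncated subtraction the identity
        fails at \<open>j = 0\<close>.\<close>
      then have "\<i> ^ (j - 1) = - \<i> * \<i> ^ j"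
        by (cases j) auto
      then show "scalar (\<i> ^ (j - 1)) * ?f False j = scalar (- \<i>) * (scalar (\<i> ^ j) * ?f False j)"
        by (simp only: sc_mult mult.assoc)
    qed simp
    finally show "?bw (rhoF N) = scalar (- \<i>) * charge False"
      by (simp add: charge_def sum_distrib_left)
  qed
  have rhoE: "rhoE N \<in> carrier_mat ?d ?d" "?bw (rhoE N) = charge True * ?P"
  proof -
    show "rhoE N \<in> carrier_mat ?d ?d"
      by (simp add: rhoE_def carrier)
    have "?bw (msum ?d (\<lambda>j. \<i> ^ j \<cdot>\<^sub>m cdag N j) {1..N}) = charge True"
      unfolding charge_def by (subst blockwise_msum) (simp_all add: sites blockwise_smult)
    then show "?bw (rhoE N) = charge True * ?P"
      by (simp add: rhoE_def blockwise_mult)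
  qed
  have centralizer_iff: "X \<in> centralizer N \<longleftrightarrow> X \<in> carrier_mat ?d ?d \<and>
      (\<forall>\<sigma>. charge \<sigma> * ?bw X = ?bw X * charge \<sigma>) \<and> ?P * ?bw X = ?bw X * ?P" for X
  proof (cases "X \<in> carrier_mat ?d ?d")
    case True
    let ?X = "?bw X"
    have F: "?X * (scalar (- \<i>) * charge False) = scalar (- \<i>) * charge False * ?X \<longleftrightarrow> charge False
      * ?X = ?X * charge False"
    proof -
      have "?X * (scalar (- \<i>) * charge False) - scalar (- \<i>) * charge False * ?X =
          scalar (- \<i>) * (?X * charge False - charge False * ?X)"
        unfolding right_diff_distrib mult.assoc sc_left_commute[of ?X] ..
      then have "?X * (scalar (- \<i>) * charge False) - scalar (- \<i>) * charge False * ?X = 0 \<longleftrightarrow>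
          ?X * charge False - charge False * ?X = 0"
        using sc_cancel[of "- \<i>"] by simp
      then show ?thesis
        by auto
    qed
    \<comment> \<open>Once \<open>?X\<close> commutes with \<open>?P\<close>, the factor
      \<open>?P\<close> of \<open>rhoE\<close> can be cancelled from the right by its
      inverse.\<close>
    have E: "?X * (charge True * ?P) = charge True * ?P * ?X \<longleftrightarrow> charge True * ?X = ?X * charge True"
      if "?P * ?X = ?X * ?P"
    proof -
      have "charge True * ?P * ?X = charge True * ?X * ?P"
        using that by (simp add: mult.assoc)
      moreover have "y = z" if "y * ?P = z * ?P" for y z
        using arg_cong[OF that, of "\<lambda>x. x * parity_inv N"] parity_inv(2) by (simp add: mult.assoc)
      ultimately show ?thesis
        by (auto simp: mult.assoc[symmetric])
    qed
    have "X \<in> centralizer N \<longleftrightarrow> ?X * (charge True * ?P) = charge True * ?P * ?X \<and>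
        ?X * (scalar (- \<i>) * charge False) = scalar (- \<i>) * charge False * ?X \<and> ?X * ?P = ?P * ?X"
      using True unfolding centralizer_def by (simp add: blockwise_commute_iff rhoE rhoF)
    then show ?thesis
      using True E unfolding F all_bool_eq by metis
  qed (simp add: centralizer_def)

  have e: "?bw (e_gen N k) = scalar \<i> * (link True k * link False k)" if "k \<in> {1..<N}" for k
  proof -
    \<comment> \<open>\<open>e_gen\<close> has the annihilation operators of its hopping terms
      first, whereas the product of links has them last.\<close>
    have "?f False k * ?f True (k + 1) = - (?f True (k + 1) * ?f False k)"
      "?f False (k + 1) * ?f True k = - (?f True k * ?f False (k + 1))"
      using that car[of k "k + 1" False True] car[of "k + 1" k False True]
      by (simp_all add: acomm_def eq_neg_iff_add_eq_0)
    then show ?thesis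
      using that by (simp add: e_gen_def sites carrier bw link_mult algebra_simps)
        (simp add: mult.assoc[symmetric] sc_mult[symmetric] sc_minus sc_1)
  qed
  \<comment> \<open>The square of the creation operator at \<open>j + 1\<close> drops out of the
    expanded product.\<close>
  have WBp: "?bw (WBp N j) = scalar ((-1) ^ j) * (link True j * link True (j + 1))"
    if "1 \<le> j" "j + 1 < N" for j
    using that f_square[of "j + 1" True] by (simp add: WBp_def sites carrier bw link_mult)
  have WBm: "?bw (WBm N j) = scalar ((-1) ^ (j + 1)) * (link False j * link False (j + 1))"
    if "1 \<le> j" "j + 1 < N" for j
    using that f_square[of "j + 1" False] by (simp add: WBm_def sites carrier bw link_mult)
  \<comment> \<open>Both products of links contain the number operator at \<open>j + 1\<close> with
    coefficient \<open>\<i>\<close>, which accounts for the term with factor 2 in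
    \<open>WB0\<close>.\<close>
  have WB0: "?bw (WB0 N j) = scalar (- 1 / 2) *
      (1 + scalar \<i> * (link True j * link False (j + 1) + link True (j + 1) * link False j))" if
        "1 \<le> j" "j + 1 < N" for j
  proof -
    have "scalar \<i> * (scalar \<i> * x) = - x" for x
      by (simp add: mult.assoc[symmetric] sc_mult[symmetric] sc_minus sc_1)
    then show ?thesis
      using that by (simp add: WB0_def sites carrier bw link_mult algebra_simps
        two_scale[symmetric])
  qed

  have gens: "x \<in> carrier_mat ?d ?d" if "x \<in> generators N" for x
    using that by (auto simp: generators_def e_gen_def WBp_def WB0_def WBm_def sites carrier)
  have gen_alg_carrier: "x \<in> carrier_mat ?d ?d" if "x \<in> gen_alg ?d (generators N)" for x
    using that by induction (auto simp: gens carrier)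
  \<comment> \<open>Each generator is a combination of 1 and products of two links. Taking any
    \<open>y\<close> that anticommutes with all links covers the charges and \<open>?P\<close> at
    once.\<close>
  have commute: "y * ?bw x = ?bw x * y"
    if y: "\<And>\<sigma> k. k \<in> {1..<N} \<Longrightarrow> acomm y (link \<sigma> k) = 0" and x: "x \<in> gen_alg ?d (generators N)"
      for x y
    using x
  proof induction
    case one
    then show ?case
      by (simp add: bw)
  next
    case (gen x)
    have pair: "y * (link \<sigma> j * link \<tau> k) = link \<sigma> j * link \<tau> k * y"
      if "j \<in> {1..<N}" "k \<in> {1..<N}" for \<sigma> \<tau> j k
      using y that by (intro commute_product)
    from gen show ?case
      by (auto simp: generators_def e WBp WBm WB0 pair sc_commute[of y] sc_left_commute[of y]
        mult.assoc distrib_left distrib_right)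
  next
    case (add x x')
    then show ?case
      by (simp add: bw gen_alg_carrier algebra_simps)
  next
    case (mult x x')
    then show ?case
      by (simp add: bw gen_alg_carrier) (metis mult.assoc)
  next
    case (smult x a)
    then show ?case
      by (simp add: bw gen_alg_carrier sc_left_commute[of y] mult.assoc)
  qed

  let ?G = "?bw ` gen_alg ?d (generators N)"
  have G_sc: "scalar a \<in> ?G" for a
  proof -
    have "scalar a = ?bw (a \<cdot>\<^sub>m 1\<^sub>m ?d)"
      by (simp add: bw)
    then show ?thesis
      by (simp only: imageI gen_alg.smult gen_alg.one)
  qed
  have G_add: "x + y \<in> ?G" and G_mult: "x * y \<in> ?G" if "x \<in> ?G" "y \<in> ?G" for x y
    using that by (auto simp: bw[symmetric] gen_alg_carrier intro!: gen_alg.add gen_alg.mult imageI)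
  have G_cancel: "x \<in> ?G" if "scalar a * x \<in> ?G" "a \<noteq> 0" for a x
  proof -
    have "scalar (1 / a) * (scalar a * x) = x"
      using that by (simp add: mult.assoc[symmetric] sc_mult[symmetric] sc_1)
    then show ?thesis
      using G_mult[OF G_sc that(1)] by metis
  qed
  have G_gen: "?bw x \<in> ?G" if "x \<in> generators N" for x
    using that by (intro imageI gen_alg.gen)
  \<comment> \<open>For \<open>N = 2\<close> the interval \<open>{1..<N - 1}\<close> is empty, in
    accordance with the absence of \<open>WB\<close> generators.\<close>
  have generators_eq: "generators N = e_gen N ` {1..<N} \<union> WBp N ` {1..<N - 1} \<union> WB0 N ` {1..<N - 1}
      \<union> WBm N ` {1..<N - 1}"
  proof -
    have "1 \<le> k \<and> k \<le> N - 1 \<longleftrightarrow> k \<in> {1..<N}" "1 \<le> k \<and> k \<le> N - 2 \<longleftrightarrow> k \<in> {1..<N - 1}" for k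
      using assms by auto
    then show ?thesis
      by (simp only: generators_def Setcompr_eq_image)
  qed
  have in_generators: "e_gen N k \<in> generators N" if "k \<in> {1..<N}" for k
    using imageI[OF that, of "e_gen N"] by (simp only: generators_eq Un_iff simp_thms)
  have in_generators': "WBp N j \<in> generators N" "WB0 N j \<in> generators N" "WBm N j \<in> generators N"
    if "1 \<le> j" "j + 1 < N" for j
  proof -
    have j: "j \<in> {1..<N - 1}"
      using that by simp
    show "WBp N j \<in> generators N" "WB0 N j \<in> generators N" "WBm N j \<in> generators N"
      using imageI[OF j, of "WBp N"] imageI[OF j, of "WB0 N"] imageI[OF j, of "WBm N"]
      by (simp_all only: generators_eq Un_iff simp_thms)
  qed
  have G_charge: "charge \<sigma> * x = x * charge \<sigma>" if "x \<in> ?G" for x \<sigma>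
    using that by (elim imageE) (simp only: commute[OF acomm_charge_link])
  have G_P: "?P * x = x * ?P" if "x \<in> ?G" for x
    using that by (elim imageE) (simp only: commute[OF acomm_P_link])
  have G_cartan: "link True j * link False j \<in> ?G" if "j \<in> {1..<N}" for j
  proof -
    have "scalar \<i> * (link True j * link False j) \<in> ?G"
      using G_gen[OF in_generators[OF that]] by (simp only: e[OF that])
    then show ?thesis
      by (rule G_cancel) simp
  qed
  have G_simple: "link \<sigma> j * link \<sigma> (j + 1) \<in> ?G" if "1 \<le> j" "j + 1 < N" for \<sigma> j
  proof (cases \<sigma>)
    case True
    have "scalar ((-1) ^ j) * (link True j * link True (j + 1)) \<in> ?G"
      using G_gen[OF in_generators'(1)[OF that]] by (simp only: WBp[OF that])
    then have "link True j * link True (j + 1) \<in> ?G"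
      by (rule G_cancel) simp
    then show ?thesis
      by (simp only: True)
  next
    case False
    have "scalar ((-1) ^ (j + 1)) * (link False j * link False (j + 1)) \<in> ?G"
      using G_gen[OF in_generators'(3)[OF that]] by (simp only: WBm[OF that])
    then have "link False j * link False (j + 1) \<in> ?G"
      by (rule G_cancel) simp
    then show ?thesis
      by (simp only: False)
  qed
  have G_mixed: "link True j * link False (j + 1) + link True (j + 1) * link False j \<in> ?G" (is "?m
    \<in> ?G")
    if "1 \<le> j" "j + 1 < N" for j
  proof -
    have "scalar (- 1 / 2) * (1 + scalar \<i> * ?m) \<in> ?G"
      using G_gen[OF in_generators'(2)[OF that]] by (simp only: WB0[OF that])
    then have "1 + scalar \<i> * ?m \<in> ?G"
      by (rule G_cancel) simp
    then have "1 + scalar \<i> * ?m + scalar (- 1) \<in> ?G"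
      by (rule G_add[OF _ G_sc])
    then have "scalar \<i> * ?m \<in> ?G"
      by (simp only: sc_minus sc_1 add_diff_cancel_left' flip: diff_conv_add_uminus)
    then show ?thesis
      by (rule G_cancel) simp
  qed
  interpret even_subalgebra scalar N ?f ?P "parity_inv N" ?G
    by unfold_locales (rule G_sc G_add G_mult G_charge G_P G_cartan G_simple G_mixed; assumption)+

  \<comment> \<open>The closure properties of \<open>Spanned\<close> are exactly the hypotheses of
    \<open>ladder_closed_full\<close>, so every matrix has the normal form.\<close>
  have full: "{X \<in> carrier_mat ?d ?d. ?bw X \<in> Spanned} = carrier_mat ?d ?d"
    by (rule ladder_closed_full)
      (auto simp: bw carrier intro: Spanned_one Spanned_add Spanned_scale Spanned_f)
  show ?thesis
  proof (rule subset_antisym; rule subsetI)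
    fix X assume "X \<in> centralizer N"
    then have X: "X \<in> carrier_mat ?d ?d" "\<And>\<sigma>. charge \<sigma> * ?bw X = ?bw X * charge \<sigma>" "?P * ?bw X =
      ?bw X * ?P"
      by (simp_all add: centralizer_iff)
    then have "?bw X \<in> ?G"
      using full by (intro commutant_subset) auto
    then obtain Y where Y: "Y \<in> gen_alg ?d (generators N)" "?bw X = ?bw Y"
      by (elim imageE)
    \<comment> \<open>Injectivity of \<open>blockwise\<close> on square matrices of this size brings
      membership back from \<open>endo\<close>.\<close>
    then have "X = Y"
      using X(1) gen_alg_carrier blockwise_eq_iff[of ?d X Y] by simp
    then show "X \<in> gen_alg ?d (generators N)"
      using Y by simp
  next
    fix X assume "X \<in> gen_alg ?d (generators N)"
    then show "X \<in> centralizer N"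
      using gen_alg_carrier commute[OF acomm_charge_link] commute[OF acomm_P_link]
        by (simp add: centralizer_iff)
  qed
qed

end
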